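(* Let $N=(\mathbb Z_2^n,+,\cdot)$ be a planar or Malone trivial nearring, let $M$ be its unique maximal ideal, where the proper ideals of $N$ are exactly the $\mathbb Z_2$-subspaces of $M$, and let $m=\dim_{\mathbb Z_2}M$. If $m$ is odd, then the ideals contained in $M$ of dimension at most $\lfloor m/2\rfloor$, together with $N$, form a maximum clique in $\operatorname{CIG}(N)$.
   Context: Nearrings are right nearrings: $(N,+)$ is a group, $(N,\cdot)$ is a semigroup, $(a+b)c=ac+bc$. An ideal is a normal subgroup $I$ of $(N,+)$ with $IN\subseteq I$ and $n(n'+i)-nn'\in I$ for $n,n'\in N$, $i\in I$. A Malone trivial nearring on a non-trivial group $G$ is given by a subset $S\subseteq G\setminus\{0\}$ and the multiplication $ab=a$ if $b\in S$, $ab=0$ if $b\notin S$. A (right) nearring $N$ is planar if, writing $a\equiv b$ when $xa=xb$ for all $x\in N$, there are at least three $\equiv$-classes and for all $a\not\equiv b$ and all $c\in N$ the equation $xa=xb+c$ has a unique solution $x\in N$. The group $\mathbb Z_2^n$ is regarded as an $n$-dimensional vector space over $\mathbb Z_2$; the dimension of an ideal is its dimension as a subspace. An ideal $I$ is a complement of an ideal $K$ if it is maximal (among ideals) with respect to $K\cap I=\{0\}$; a complement ideal is a complement of some ideal. The complement ideal graph $\operatorname{CIG}(N)$ is the simple graph whose vertices are all ideals of $N$, distinct $I,J$ being adjacent iff $I+J$ is a complement ideal. A clique is a maximal complete subgraph; a maximum clique is a clique of largest order. *)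

theory Defs
  imports "HOL-Analysis.Analysis" "HOL-Library.Z2"
begin

text \<open>
  A nearring here lives on a whole type of class \<open>group_add\<close> (which need not be commutative);
  its multiplication is passed around explicitly as a binary function.
\<close>

locale right_nearring = semigroup mul
  for mul :: "'a::group_add \<Rightarrow> 'a \<Rightarrow> 'a" +
  assumes distrib_right: "mul (a + b) c = mul a c + mul b c"

definition malone_trivial :: "('a::group_add \<Rightarrow> 'a \<Rightarrow> 'a) \<Rightarrow> bool" where
  "malone_trivial mul \<longleftrightarrow>
     (\<exists>g::'a. g \<noteq> 0) \<and>
     (\<exists>S \<subseteq> UNIV - {0}. \<forall>a b. mul a b = (if b \<in> S then a else 0))"

definition mult_equiv :: "('a::group_add \<Rightarrow> 'a \<Rightarrow> 'a) \<Rightarrow> ('a \<times> 'a) set" where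
  "mult_equiv mul = {(a, b). \<forall>x. mul x a = mul x b}"

text \<open>
  ``At least three classes'' is phrased through a three-element set of classes because
  \<open>card\<close> is 0 on infinite quotients.
\<close>

definition planar :: "('a::group_add \<Rightarrow> 'a \<Rightarrow> 'a) \<Rightarrow> bool" where
  "planar mul \<longleftrightarrow>
     right_nearring mul \<and>
     (\<exists>Q \<subseteq> UNIV // mult_equiv mul. card Q = 3) \<and>
     (\<forall>a b c. (a, b) \<notin> mult_equiv mul \<longrightarrow> (\<exists>!x. mul x a = mul x b + c))"

definition normal_add_subgroup :: "'a::group_add set \<Rightarrow> bool" where
  "normal_add_subgroup I \<longleftrightarrow>
     0 \<in> I \<and> (\<forall>x\<in>I. \<forall>y\<in>I. x + y \<in> I) \<and> (\<forall>x\<in>I. - x \<in> I) \<and>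
     (\<forall>g. \<forall>x\<in>I. g + x - g \<in> I)"

definition nr_ideal :: "('a::group_add \<Rightarrow> 'a \<Rightarrow> 'a) \<Rightarrow> 'a set \<Rightarrow> bool" where
  "nr_ideal mul I \<longleftrightarrow>
     normal_add_subgroup I \<and>
     (\<forall>i\<in>I. \<forall>n. mul i n \<in> I) \<and>
     (\<forall>n n'. \<forall>i\<in>I. mul n (n' + i) - mul n n' \<in> I)"

definition maximal_nr_ideal :: "('a::group_add \<Rightarrow> 'a \<Rightarrow> 'a) \<Rightarrow> 'a set \<Rightarrow> bool" where
  "maximal_nr_ideal mul M \<longleftrightarrow>
     nr_ideal mul M \<and> M \<noteq> UNIV \<and>
     (\<forall>J. nr_ideal mul J \<and> M \<subseteq> J \<and> J \<noteq> UNIV \<longrightarrow> J = M)"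

definition complement_of :: "('a::group_add \<Rightarrow> 'a \<Rightarrow> 'a) \<Rightarrow> 'a set \<Rightarrow> 'a set \<Rightarrow> bool" where
  "complement_of mul K I \<longleftrightarrow>
     nr_ideal mul I \<and> K \<inter> I = {0} \<and>
     (\<forall>J. nr_ideal mul J \<and> K \<inter> J = {0} \<and> I \<subseteq> J \<longrightarrow> J = I)"

definition complement_ideal :: "('a::group_add \<Rightarrow> 'a \<Rightarrow> 'a) \<Rightarrow> 'a set \<Rightarrow> bool" where
  "complement_ideal mul I \<longleftrightarrow> (\<exists>K. nr_ideal mul K \<and> complement_of mul K I)"

text \<open>
  The complement ideal graph, given by its vertex set and its adjacency relation.  The sum
  \<open>I + J\<close> of sets is the elementwise one from \<open>HOL-Library.Set_Algebras\<close>.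
\<close>

definition cig_verts :: "('a::group_add \<Rightarrow> 'a \<Rightarrow> 'a) \<Rightarrow> 'a set set" where
  "cig_verts mul = {I. nr_ideal mul I}"

definition cig_adj :: "('a::group_add \<Rightarrow> 'a \<Rightarrow> 'a) \<Rightarrow> 'a set \<Rightarrow> 'a set \<Rightarrow> bool" where
  "cig_adj mul I J \<longleftrightarrow>
     I \<in> cig_verts mul \<and> J \<in> cig_verts mul \<and> I \<noteq> J \<and> complement_ideal mul (I + J)"

text \<open>
  Complete subgraphs are identified with their vertex sets.
\<close>

definition complete_in :: "'v set \<Rightarrow> ('v \<Rightarrow> 'v \<Rightarrow> bool) \<Rightarrow> 'v set \<Rightarrow> bool" where
  "complete_in V adj C \<longleftrightarrow> C \<subseteq> V \<and> (\<forall>x\<in>C. \<forall>y\<in>C. x \<noteq> y \<longrightarrow> adj x y)"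

definition clique_in :: "'v set \<Rightarrow> ('v \<Rightarrow> 'v \<Rightarrow> bool) \<Rightarrow> 'v set \<Rightarrow> bool" where
  "clique_in V adj C \<longleftrightarrow>
     complete_in V adj C \<and> (\<forall>D. complete_in V adj D \<and> C \<subseteq> D \<longrightarrow> D = C)"

text \<open>
  The finiteness clauses keep the comparison of cardinalities meaningful, since \<open>card\<close> is 0
  on infinite sets.
\<close>

definition maximum_clique_in :: "'v set \<Rightarrow> ('v \<Rightarrow> 'v \<Rightarrow> bool) \<Rightarrow> 'v set \<Rightarrow> bool" where
  "maximum_clique_in V adj C \<longleftrightarrow>
     clique_in V adj C \<and> finite C \<and>
     (\<forall>D. clique_in V adj D \<longrightarrow> finite D \<and> card D \<le> card C)"

end

theory Submission
  imports Defs
begin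

text \<open>
  The complement ideals are exactly the ideals other than \<open>M\<close>, so distinct proper ideals are
  adjacent unless they add up to \<open>M\<close>, and \<open>UNIV\<close> is adjacent to everything else. For
  \<open>k \<le> m div 2\<close>, the pairs of complementary subspaces of \<open>M\<close> of dimensions \<open>k\<close> and \<open>m - k\<close> are
  the edges of a regular bipartite graph: every vertex has degree \<open>2 ^ (k * (m - k))\<close>. A clique is
  an independent set of this graph, so it has at most as many members of dimension \<open>k\<close> or \<open>m - k\<close>
  as there are subspaces of dimension \<open>k\<close>. As \<open>m\<close> is odd, summing over \<open>k \<le> m div 2\<close> accounts
  for all dimensions.
\<close>

section \<open>Complements of subspaces over a finite field\<close>

text \<open>Double counting of the edges between \<open>X\<close> and \<open>B - Y\<close>: every
  vertex of \<open>X\<close> sends all its \<open>d\<close> edges there, and every vertex of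
  \<open>B - Y\<close> receives at most \<open>d\<close>. Hence \<open>X\<close> is no larger than
  \<open>B - Y\<close>.\<close>

lemma card_independent_regular_bipartite:
  fixes R :: "'a \<Rightarrow> 'b \<Rightarrow> bool"
  assumes fin: "finite A" "finite B"
    and degA: "\<And>a. a \<in> A \<Longrightarrow> card {b\<in>B. R a b} = d"
    and degB: "\<And>b. b \<in> B \<Longrightarrow> card {a\<in>A. R a b} = d"
    and "0 < d" and "X \<subseteq> A" "Y \<subseteq> B"
    and indep: "\<And>a b. a \<in> X \<Longrightarrow> b \<in> Y \<Longrightarrow> \<not> R a b"
  shows "card X + card Y \<le> card A"
proof -
  have "d * card X = (\<Sum>a\<in>X. card {b\<in>B - Y. R a b})"
  proof -
    have "card {b\<in>B - Y. R a b} = d" if "a \<in> X" for a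
    proof -
      have "{b\<in>B - Y. R a b} = {b\<in>B. R a b}"
        using indep that by blast
      then show ?thesis using degA that \<open>X \<subseteq> A\<close> by auto
    qed
    then show ?thesis by simp
  qed
  also have "\<dots> = (\<Sum>b\<in>B - Y. card {a\<in>X. R a b})"
    using finite_subset[OF \<open>X \<subseteq> A\<close>] fin by (intro sum_multicount_gen) auto
  also have "\<dots> \<le> (\<Sum>b\<in>B - Y. d)"
  proof (rule sum_mono)
    fix b assume "b \<in> B - Y"
    then have "d = card {a\<in>A. R a b}" using degB by simp
    moreover have "card {a\<in>X. R a b} \<le> card {a\<in>A. R a b}"
      using fin \<open>X \<subseteq> A\<close> by (intro card_mono) auto
    ultimately show "card {a\<in>X. R a b} \<le> d" by simp
  qed
  also have "\<dots> = d * (card B - card Y)"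
    using \<open>Y \<subseteq> B\<close> fin by (simp add: card_Diff_subset finite_subset)
  finally have "card X \<le> card B - card Y" using \<open>0 < d\<close> by simp
  moreover have "card Y \<le> card B" using \<open>Y \<subseteq> B\<close> fin by (simp add: card_mono)
  \<comment> \<open>Counting all edges from either side gives
    \<open>d * card A = d * card B\<close>.\<close>
  moreover have "card A = card B"
  proof -
    have "d * card A = (\<Sum>a\<in>A. card {b\<in>B. R a b})" using degA by simp
    also have "\<dots> = d * card B" using degB fin by (intro sum_multicount) auto
    finally show ?thesis using \<open>0 < d\<close> by simp
  qed
  ultimately show ?thesis by simp
qed

section \<open>Sums and intersections of subspaces, and their dimensions\<close>

lemma subspace_set_plus:
  fixes S T :: "('a::field ^ 'n) set"
  assumes "vec.subspace S" "vec.subspace T"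
  shows "vec.subspace (S + T)"
proof -
  have "S + T = {x + y |x y. x \<in> S \<and> y \<in> T}" by (auto simp: set_plus_def)
  then show ?thesis using vec.subspace_sums[OF assms] by simp
qed

lemma dim_set_plus_Int:
  fixes S T :: "('a::field ^ 'n) set"
  assumes "vec.subspace S" "vec.subspace T"
  shows "vec.dim (S + T) + vec.dim (S \<inter> T) = vec.dim S + vec.dim T"
proof -
  have "S + T = {x + y |x y. x \<in> S \<and> y \<in> T}" by (auto simp: set_plus_def)
  then show ?thesis using vec.dim_sums_Int[OF assms] by simp
qed

lemma set_plus_subset_subspace:
  fixes M :: "('a::field ^ 'n) set"
  assumes "vec.subspace M" "S \<subseteq> M" "T \<subseteq> M"
  shows "S + T \<subseteq> M"
  using assms by (auto simp: set_plus_def intro!: vec.subspace_add)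

lemma subset_set_plus:
  fixes S T :: "('a::field ^ 'n) set"
  assumes "vec.subspace S" "vec.subspace T"
  shows "S \<subseteq> S + T" "T \<subseteq> S + T"
  using set_plus_intro[OF _ vec.subspace_0[OF assms(2)]]
    set_plus_intro[OF vec.subspace_0[OF assms(1)]] by force+

lemma subspace_Int_trivial:
  fixes S :: "('a::field ^ 'n) set"
  assumes "vec.subspace S" "vec.subspace T" "vec.dim (S \<inter> T) = 0"
  shows "S \<inter> T = {0}"
  using assms vec.subspace_0 by auto

text \<open>Each new basis vector \<open>b\<close> multiplies the size by the number of scalars,
  since \<open>(k, x)\<close> corresponds bijectively to \<open>k *s b + x\<close>.\<close>

lemma card_span_independent:
  fixes B :: "('a::{field,finite} ^ 'n) set"
  assumes "vec.independent B"
  shows "card (vec.span B) = CARD('a) ^ card B"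
proof -
  have "finite B" by simp
  then show ?thesis using assms
  proof (induction B)
    case empty
    then show ?case by simp
  next
    case (insert b B)
    let ?f = "\<lambda>(k, x). k *s b + x"
    have b: "b \<notin> vec.span B" and ind: "vec.independent B"
      using insert.prems insert.hyps vec.independent_insert[of b B] by simp_all
    have "inj_on ?f (UNIV \<times> vec.span B)"
    proof (rule inj_onI, clarify)
      fix k l x y
      assume x: "x \<in> vec.span B" and y: "y \<in> vec.span B" and eq: "k *s b + x = l *s b + y"
      \<comment> \<open>If \<open>k\<close> and \<open>l\<close> differed, dividing by
        \<open>k - l\<close> would put \<open>b\<close> into the span of \<open>B\<close>.\<close>
      have *: "(k - l) *s b = y - x"
        using eq by (simp add: vec.scale_left_diff_distrib algebra_simps)
      then have "(k - l) *s b \<in> vec.span B" using x y by (simp add: vec.span_diff)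
      then have "inverse (k - l) *s ((k - l) *s b) \<in> vec.span B" by (rule vec.span_scale)
      moreover have "inverse (k - l) *s ((k - l) *s b) = b" if "k - l \<noteq> 0"
        unfolding vec.scale_scale left_inverse[OF that] by simp
      ultimately have "k - l = 0" using b by fastforce
      then show "k = l \<and> x = y" using * by simp
    qed
    moreover have "?f ` (UNIV \<times> vec.span B) = vec.span (insert b B)"
    proof -
      have "x \<in> ?f ` (UNIV \<times> vec.span B)" if "x - k *s b \<in> vec.span B" for x k
        using that by (intro image_eqI[of _ _ "(k, x - k *s b)"]) auto
      moreover have "\<exists>k'. (k *s b + x) - k' *s b \<in> vec.span B" if "x \<in> vec.span B" for x k
        using that by (intro exI[of _ k]) simp
      ultimately show ?thesis unfolding vec.span_insert by auto
    qed
    ultimately have "card (vec.span (insert b B)) = CARD('a) * card (vec.span B)"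
      by (metis card_image card_cartesian_product)
    then show ?case using insert ind by simp
  qed
qed

lemma card_subspace:
  fixes W :: "('a::{field,finite} ^ 'n) set"
  assumes "vec.subspace W"
  shows "card W = CARD('a) ^ vec.dim W"
  by (metis assms card_span_independent vec.basis_subspace_exists)

text \<open>
  Fix a basis \<open>B\<close> of one complement. Every complement is spanned by the vectors \<open>b + f b\<close> with
  \<open>b \<in> B\<close> for a unique function \<open>f\<close> from \<open>B\<close> to \<open>W\<close>.
\<close>

lemma card_complements:
  fixes W M :: "('a::{field,finite} ^ 'n) set"
  assumes W: "vec.subspace W" and M: "vec.subspace M" and "W \<subseteq> M"
  shows "card {C. vec.subspace C \<and> C \<subseteq> M \<and> vec.dim C = vec.dim M - vec.dim W \<and> W + C = M}
           = CARD('a) ^ (vec.dim W * (vec.dim M - vec.dim W))" (is "card ?Cs = _")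
proof -
  obtain A where A: "A \<subseteq> W" "vec.independent A" "vec.span A = W" "card A = vec.dim W"
    using vec.basis_subspace_exists[OF W] by metis
  obtain E where E: "A \<subseteq> E" "E \<subseteq> M" "vec.independent E" "M \<subseteq> vec.span E"
    using vec.maximal_independent_subset_extend[of A M] A \<open>W \<subseteq> M\<close> by (metis subset_trans)
  define B where "B = E - A"
  have finB: "finite B" and BM: "B \<subseteq> M" using E by (auto simp: B_def)
  have cardB: "card B = vec.dim M - vec.dim W"
    using E A vec.basis_card_eq_dim[of E M] by (simp add: B_def card_Diff_subset)
  define \<Phi> where "\<Phi> f = vec.span ((\<lambda>b. b + f b) ` B)" for f
  have \<Phi>: "\<Phi> f \<in> ?Cs \<and> W \<inter> \<Phi> f = {0}" if f: "f \<in> B \<rightarrow>\<^sub>E W" for f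
  proof -
    have sub: "vec.subspace (\<Phi> f)" by (simp add: \<Phi>_def)
    have "(\<lambda>b. b + f b) ` B \<subseteq> M"
      using f BM \<open>W \<subseteq> M\<close> M by (auto intro!: vec.subspace_add)
    then have sM: "\<Phi> f \<subseteq> M" unfolding \<Phi>_def by (simp add: M vec.span_minimal)
    have "E \<subseteq> W + \<Phi> f"
    proof
      fix b assume "b \<in> E"
      show "b \<in> W + \<Phi> f"
      proof (cases "b \<in> A")
        case True
        then show ?thesis using A(1) subset_set_plus(1)[OF W sub] by blast
      next
        case False
        then have "b \<in> B" using \<open>b \<in> E\<close> by (simp add: B_def)
        \<comment> \<open>The shift by \<open>f b\<close> can be undone inside \<open>W\<close>, so
          the sum still contains \<open>b\<close>.\<close>
        then have "- f b \<in> W" "b + f b \<in> \<Phi> f"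
          using f W by (auto simp: \<Phi>_def intro!: vec.subspace_neg vec.span_base)
        then have "- f b + (b + f b) \<in> W + \<Phi> f" by blast
        then show ?thesis by simp
      qed
    qed
    then have "M \<subseteq> W + \<Phi> f"
      using E(4) vec.span_minimal[OF _ subspace_set_plus[OF W sub]] by blast
    then have eq: "W + \<Phi> f = M" using set_plus_subset_subspace[OF M \<open>W \<subseteq> M\<close> sM] by blast
    \<comment> \<open>The number of generators bounds the dimension from above; the dimension
      formula for \<open>W + \<Phi> f = M\<close> bounds it from below. Equality makes the
      intersection trivial.\<close>
    have "vec.dim (\<Phi> f) \<le> card B"
      unfolding \<Phi>_def vec.dim_span
      using vec.dim_le_card'[of "(\<lambda>b. b + f b) ` B"] card_image_le[OF finB] finB
      by (meson finite_imageI le_trans)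
    moreover have "vec.dim M + vec.dim (W \<inter> \<Phi> f) = vec.dim W + vec.dim (\<Phi> f)"
      using dim_set_plus_Int[OF W sub] eq by simp
    moreover have "vec.dim W \<le> vec.dim M" by (rule vec.dim_subset[OF \<open>W \<subseteq> M\<close>])
    ultimately have "vec.dim (\<Phi> f) = vec.dim M - vec.dim W" "vec.dim (W \<inter> \<Phi> f) = 0"
      using cardB by linarith+
    then show ?thesis using sub sM eq subspace_Int_trivial[OF W sub] by blast
  qed
  have "inj_on \<Phi> (B \<rightarrow>\<^sub>E W)"
  proof (rule inj_onI)
    fix f g assume f: "f \<in> B \<rightarrow>\<^sub>E W" and g: "g \<in> B \<rightarrow>\<^sub>E W" and eq: "\<Phi> f = \<Phi> g"
    have "f b = g b" if "b \<in> B" for b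
    proof -
      \<comment> \<open>The difference \<open>f b - g b\<close> lies both in \<open>W\<close> and in
        \<open>\<Phi> f\<close>, which meet only in 0.\<close>
      have "b + f b \<in> \<Phi> f" "b + g b \<in> \<Phi> f"
        using that eq unfolding \<Phi>_def by (auto intro: vec.span_base)
      then have "(b + f b) - (b + g b) \<in> \<Phi> f" unfolding \<Phi>_def by (rule vec.span_diff)
      then have "f b - g b \<in> \<Phi> f" by simp
      moreover have "f b - g b \<in> W" using f g that W by (auto intro: vec.subspace_diff)
      ultimately have "f b - g b = 0" using \<Phi>[OF f] by blast
      then show ?thesis by simp
    qed
    then show "f = g" using f g by (meson PiE_ext)
  qed
  moreover have "\<Phi> ` (B \<rightarrow>\<^sub>E W) = ?Cs"
  proof
    show "\<Phi> ` (B \<rightarrow>\<^sub>E W) \<subseteq> ?Cs" using \<Phi> by blast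
    show "?Cs \<subseteq> \<Phi> ` (B \<rightarrow>\<^sub>E W)"
    proof
      fix C assume C: "C \<in> ?Cs"
      have "\<exists>w\<in>W. b + w \<in> C" if "b \<in> B" for b
      proof -
        \<comment> \<open>Writing \<open>b = w + c\<close> gives the value \<open>- w\<close>, as
          \<open>b - w = c\<close> lies in \<open>C\<close>.\<close>
        have "b \<in> W + C" using C that BM by blast
        then obtain w c where "w \<in> W" "c \<in> C" "b = w + c" by (auto elim: set_plus_elim)
        then show ?thesis using W by (intro bexI[of _ "- w"]) (auto intro: vec.subspace_neg)
      qed
      then obtain h where h: "\<And>b. b \<in> B \<Longrightarrow> h b \<in> W \<and> b + h b \<in> C" by metis
      \<comment> \<open>Restriction makes the function extensional, as membership in
        \<open>B \<rightarrow>\<^sub>E W\<close> demands.\<close>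
      define f where "f = restrict h B"
      have f: "f \<in> B \<rightarrow>\<^sub>E W" using h by (auto simp: f_def)
      have "(\<lambda>b. b + f b) ` B \<subseteq> C" using h by (auto simp: f_def)
      then have "\<Phi> f \<subseteq> C" unfolding \<Phi>_def using C by (simp add: vec.span_minimal)
      then have "\<Phi> f = C" using \<Phi>[OF f] C by (intro vec.subspace_dim_equal) auto
      then show "C \<in> \<Phi> ` (B \<rightarrow>\<^sub>E W)" using f by blast
    qed
  qed
  ultimately have "card ?Cs = card (B \<rightarrow>\<^sub>E W)" by (metis card_image)
  also have "\<dots> = CARD('a) ^ (vec.dim W * (vec.dim M - vec.dim W))"
    using finB card_subspace[OF W] cardB by (simp add: card_PiE power_mult)
  finally show ?thesis .
qed

text \<open>Extend a basis of \<open>W\<close> to one of \<open>M\<close> and span the added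
  vectors. The field may be infinite here, so the counting lemma does not supply this.\<close>

lemma complement_exists:
  fixes W M :: "('a::field ^ 'n) set"
  assumes W: "vec.subspace W" and M: "vec.subspace M" and "W \<subseteq> M"
  obtains C where "vec.subspace C" "C \<subseteq> M" "W + C = M" "W \<inter> C = {0}"
proof -
  obtain A where A: "A \<subseteq> W" "vec.independent A" "vec.span A = W" "card A = vec.dim W"
    using vec.basis_subspace_exists[OF W] by metis
  obtain E where E: "A \<subseteq> E" "E \<subseteq> M" "vec.independent E" "M \<subseteq> vec.span E"
    using vec.maximal_independent_subset_extend[of A M] A \<open>W \<subseteq> M\<close> by (metis subset_trans)
  define C where "C = vec.span (E - A)"
  have C: "vec.subspace C" "C \<subseteq> M"
    using E(2) vec.span_minimal[OF _ M, of "E - A"] by (auto simp: C_def)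
  have "E \<subseteq> W + C"
    using subset_set_plus[OF W C(1)] A(1) vec.span_superset[of "E - A"] unfolding C_def by blast
  then have "M \<subseteq> W + C"
    using E(4) vec.span_minimal[OF _ subspace_set_plus[OF W C(1)]] by blast
  then have eq: "W + C = M" using set_plus_subset_subspace[OF M \<open>W \<subseteq> M\<close> C(2)] by blast
  have "vec.independent (E - A)" using E(3) vec.independent_mono by blast
  then have "vec.dim C = card (E - A)" unfolding C_def by (rule vec.dim_span_eq_card_independent)
  moreover have "card (E - A) = vec.dim M - vec.dim W"
    using E A vec.basis_card_eq_dim[of E M] vec.finiteI_independent[OF A(2)]
    by (simp add: card_Diff_subset)
  moreover have "vec.dim W \<le> vec.dim M" by (rule vec.dim_subset[OF \<open>W \<subseteq> M\<close>])
  ultimately have "vec.dim (W \<inter> C) = 0"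
    using dim_set_plus_Int[OF W C(1)] eq by simp
  then show thesis using that C eq subspace_Int_trivial[OF W C(1)] by blast
qed

lemma card_subspace_family_le:
  fixes M :: "('a::{field,finite} ^ 'n) set"
  assumes M: "vec.subspace M" and odd: "odd (vec.dim M)"
    and F: "\<And>I. I \<in> F \<Longrightarrow> vec.subspace I \<and> I \<subseteq> M"
    and sums: "\<And>I J. I \<in> F \<Longrightarrow> J \<in> F \<Longrightarrow> I \<noteq> J \<Longrightarrow> I + J \<noteq> M"
  shows "card F \<le> card {I. vec.subspace I \<and> I \<subseteq> M \<and> vec.dim I \<le> vec.dim M div 2}"
proof -
  define m where "m = vec.dim M"
  define V where "V k = {I. vec.subspace I \<and> I \<subseteq> M \<and> vec.dim I = k}" for k
  have level: "card (F \<inter> V k) + card (F \<inter> V (m - k)) \<le> card (V k)" if k: "k \<le> m div 2" for k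
  proof (rule card_independent_regular_bipartite)
    show "card {C \<in> V (m - k). W + C = M} = CARD('a) ^ (k * (m - k))" if "W \<in> V k" for W
    proof -
      have "{C \<in> V (m - k). W + C = M} =
          {C. vec.subspace C \<and> C \<subseteq> M \<and> vec.dim C = vec.dim M - vec.dim W \<and> W + C = M}"
        using that by (auto simp: V_def m_def)
      then show ?thesis using card_complements[of W M] that M by (simp add: V_def m_def)
    qed
    show "card {W \<in> V k. W + C = M} = CARD('a) ^ (k * (m - k))" if "C \<in> V (m - k)" for C
    proof -
      \<comment> \<open>This turns level \<open>k\<close> into the complementary dimension of
        \<open>C\<close>, so both sides of the bipartite graph have the same degree.\<close>
      have "m - (m - k) = k" using k by simp
      then have "{W \<in> V k. W + C = M} =
          {W. vec.subspace W \<and> W \<subseteq> M \<and> vec.dim W = vec.dim M - vec.dim C \<and> C + W = M}"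
        using that by (auto simp: V_def m_def add.commute)
      then show ?thesis
        using card_complements[of C M] that M k by (simp add: V_def m_def mult.commute)
    qed
    show "\<not> I + J = M" if "I \<in> F \<inter> V k" "J \<in> F \<inter> V (m - k)" for I J
    proof -
      \<comment> \<open>Oddness rules out a middle level paired with itself, so \<open>I\<close> and
        \<open>J\<close> are distinct and \<open>sums\<close> applies.\<close>
      have "odd m" using odd by (simp add: m_def)
      then have "k \<noteq> m - k" using k by presburger
      then have "I \<noteq> J" using that by (auto simp: V_def)
      then show ?thesis using sums that by blast
    qed
  qed auto
  have "F \<subseteq> (\<Union>k\<le>m div 2. F \<inter> V k \<union> F \<inter> V (m - k))"
  proof
    fix I assume I: "I \<in> F"
    then have le: "vec.dim I \<le> m" unfolding m_def using F by (intro vec.dim_subset) blast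
    show "I \<in> (\<Union>k\<le>m div 2. F \<inter> V k \<union> F \<inter> V (m - k))"
    proof (cases "vec.dim I \<le> m div 2")
      case True
      then show ?thesis using I F by (auto simp: V_def)
    next
      case False
      then have "m - vec.dim I \<le> m div 2" by linarith
      then show ?thesis using I F le by (intro UN_I[of "m - vec.dim I"]) (auto simp: V_def)
    qed
  qed
  \<comment> \<open>For \<open>F\<close> subadditivity suffices; only the levels \<open>V k\<close>
    on the right have to be disjoint.\<close>
  then have "card F \<le> card (\<Union>k\<le>m div 2. F \<inter> V k \<union> F \<inter> V (m - k))"
    by (intro card_mono) auto
  also have "\<dots> \<le> (\<Sum>k\<le>m div 2. card (F \<inter> V k \<union> F \<inter> V (m - k)))"
    by (intro card_UN_le) auto
  also have "\<dots> \<le> (\<Sum>k\<le>m div 2. card (V k))"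
    using level by (intro sum_mono order_trans[OF card_Un_le]) simp
  also have "\<dots> = card (\<Union>k\<le>m div 2. V k)"
    by (intro card_UN_disjoint[symmetric]) (auto simp: V_def)
  also have "(\<Union>k\<le>m div 2. V k) = {I. vec.subspace I \<and> I \<subseteq> M \<and> vec.dim I \<le> vec.dim M div 2}"
    by (auto simp: V_def m_def)
  finally show ?thesis .
qed

section \<open>The complement ideal graph\<close>

text \<open>Makes the counting results over finite fields applicable to
  \<open>bit ^ 'n\<close>.\<close>

instance bit :: finite
proof
  have "(UNIV :: bit set) \<subseteq> {0, 1}" using bit_not_one_iff by blast
  then show "finite (UNIV :: bit set)" by (rule finite_subset) simp
qed

lemma nr_ideal_UNIV: "nr_ideal mul UNIV"
  by (simp add: nr_ideal_def normal_add_subgroup_def)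

lemma complement_ideal_UNIV:
  assumes "nr_ideal mul {0}"
  shows "complement_ideal mul UNIV"
  using assms nr_ideal_UNIV
  unfolding complement_ideal_def complement_of_def by (intro exI[of _ "{0}"]) auto

text \<open>A bound on all complete sets also yields maximality under inclusion: a complete superset
  of \<open>C\<close> cannot be larger than \<open>C\<close>, so it equals \<open>C\<close>.\<close>

lemma maximum_clique_inI:
  assumes "complete_in V adj C" "finite V"
    and "\<And>D. complete_in V adj D \<Longrightarrow> card D \<le> card C"
  shows "maximum_clique_in V adj C"
proof -
  have "finite D" if "complete_in V adj D" for D
    using that \<open>finite V\<close> finite_subset by (auto simp: complete_in_def)
  then show ?thesis
    using assms unfolding maximum_clique_in_def clique_in_def by (metis card_seteq)
qed

text \<open>An ideal meeting \<open>M\<close> trivially is zero, and its only complement is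
  \<open>UNIV\<close>. Any other proper ideal \<open>I\<close> is a complement of a vector space
  complement \<open>K\<close> of \<open>I\<close> in \<open>M\<close>.\<close>

lemma complement_ideal_iff:
  fixes mul :: "'a::field ^ 'n \<Rightarrow> 'a ^ 'n \<Rightarrow> 'a ^ 'n"
  assumes ideals: "\<And>I. nr_ideal mul I \<and> I \<noteq> UNIV \<longleftrightarrow> vec.subspace I \<and> I \<subseteq> M"
    and "vec.subspace M" "M \<noteq> UNIV" "M \<noteq> {0}"
  shows "complement_ideal mul I \<longleftrightarrow> nr_ideal mul I \<and> I \<noteq> M"
proof
  assume "complement_ideal mul I"
  then obtain K where K: "nr_ideal mul K" and c: "complement_of mul K I"
    unfolding complement_ideal_def by (elim exE conjE)
  have I: "nr_ideal mul I" "K \<inter> I = {0}"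
    and max: "\<And>J. nr_ideal mul J \<Longrightarrow> K \<inter> J = {0} \<Longrightarrow> I \<subseteq> J \<Longrightarrow> J = I"
    using c unfolding complement_of_def by simp_all
  have "I \<noteq> M"
  proof
    assume "I = M"
    then have "K \<noteq> UNIV" using I(2) \<open>M \<noteq> {0}\<close> by auto
    then have "K \<subseteq> M" using ideals K by blast
    \<comment> \<open>Here \<open>K\<close> is zero, so the strictly larger ideal
      \<open>UNIV\<close> violates the maximality of \<open>M\<close>.\<close>
    then have "K \<inter> UNIV = {0}" using I(2) \<open>I = M\<close> by blast
    then show False using max[OF nr_ideal_UNIV] \<open>I = M\<close> \<open>M \<noteq> UNIV\<close> by blast
  qed
  then show "nr_ideal mul I \<and> I \<noteq> M" using I by blast
next
  assume I: "nr_ideal mul I \<and> I \<noteq> M"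
  show "complement_ideal mul I"
  proof (cases "I = UNIV")
    case True
    have "nr_ideal mul {0}" using ideals \<open>vec.subspace M\<close> vec.subspace_0 by force
    then show ?thesis using True complement_ideal_UNIV by blast
  next
    case False
    then have sI: "vec.subspace I" "I \<subseteq> M" using I ideals by blast+
    obtain K where K: "vec.subspace K" "K \<subseteq> M" "I + K = M" "I \<inter> K = {0}"
      using complement_exists[OF sI(1) \<open>vec.subspace M\<close> sI(2)] .
    have "K \<noteq> {0}" using K(3) I by auto
    have "J = I" if J: "nr_ideal mul J" "K \<inter> J = {0}" "I \<subseteq> J" for J
    proof -
      \<comment> \<open>A nonzero \<open>K\<close> excludes \<open>UNIV\<close>; a larger subspace
        of \<open>M\<close> is then excluded by dimension.\<close>
      have "J \<noteq> UNIV" using J(2) \<open>K \<noteq> {0}\<close> by auto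
      then have sJ: "vec.subspace J" "J \<subseteq> M" using J(1) ideals by blast+
      have "vec.dim (K + J) \<le> vec.dim M"
        using set_plus_subset_subspace[OF \<open>vec.subspace M\<close> K(2) sJ(2)] by (rule vec.dim_subset)
      then have "vec.dim J \<le> vec.dim I"
        using dim_set_plus_Int[OF K(1) sJ(1)] dim_set_plus_Int[OF sI(1) K(1)] J(2) K(3,4)
        by simp
      then show ?thesis using vec.subspace_dim_equal[OF sI(1) sJ(1) J(3)] by simp
    qed
    moreover have "nr_ideal mul K" using K ideals by blast
    ultimately show ?thesis
      using I K(4) unfolding complement_ideal_def complement_of_def
      by (intro exI[of _ K]) (auto simp: Int_commute)
  qed
qed

theorem theorem4p30:
  fixes mul :: "bit ^ 'n \<Rightarrow> bit ^ 'n \<Rightarrow> bit ^ 'n"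
    and M :: "(bit ^ 'n) set"
    and m :: nat
  assumes "right_nearring mul"
    and "planar mul \<or> malone_trivial mul"
    and "maximal_nr_ideal mul M"
    and "\<And>M'. maximal_nr_ideal mul M' \<Longrightarrow> M' = M"
    and "\<And>I. (nr_ideal mul I \<and> I \<noteq> UNIV) \<longleftrightarrow> (vec.subspace I \<and> I \<subseteq> M)"
    and "m = vec.dim M"
    and "odd m"
  shows "maximum_clique_in (cig_verts mul) (cig_adj mul)
           ({I. nr_ideal mul I \<and> I \<subseteq> M \<and> vec.dim I \<le> m div 2} \<union> {UNIV})"
proof -
  note ideals = assms(5)
  have "M \<noteq> UNIV" "nr_ideal mul M" using assms(3) by (auto simp: maximal_nr_ideal_def)
  then have M: "vec.subspace M" using ideals by blast
  \<comment> \<open>The zero space has even dimension 0.\<close>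
  have "M \<noteq> {0}" using \<open>odd m\<close> \<open>m = vec.dim M\<close> by auto
  note comp = complement_ideal_iff[OF ideals M \<open>M \<noteq> UNIV\<close> \<open>M \<noteq> {0}\<close>]
  have ne: "I \<noteq> {}" if "nr_ideal mul I" for I
    using that by (auto simp: nr_ideal_def normal_add_subgroup_def)
  have absorb: "UNIV + I = UNIV" "I + UNIV = UNIV" if I: "nr_ideal mul I" for I
  proof -
    obtain i where i: "i \<in> I" using ne[OF I] by blast
    have "x \<in> UNIV + I" for x using set_plus_intro[OF UNIV_I i, of "x - i"] by simp
    then show "UNIV + I = UNIV" by blast
    then show "I + UNIV = UNIV" by (simp add: add.commute)
  qed
  define L where "L = {I. vec.subspace I \<and> I \<subseteq> M \<and> vec.dim I \<le> m div 2}"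
  have L: "{I. nr_ideal mul I \<and> I \<subseteq> M \<and> vec.dim I \<le> m div 2} = L"
    unfolding L_def using ideals \<open>M \<noteq> UNIV\<close> by blast
  have "UNIV \<notin> L" using \<open>M \<noteq> UNIV\<close> by (auto simp: L_def)
  show ?thesis unfolding L
  proof (rule maximum_clique_inI)
    show "complete_in (cig_verts mul) (cig_adj mul) (L \<union> {UNIV})"
      unfolding complete_in_def
    proof (intro conjI ballI impI)
      show verts: "L \<union> {UNIV} \<subseteq> cig_verts mul"
        using ideals nr_ideal_UNIV by (auto simp: L_def cig_verts_def)
      fix I J assume I: "I \<in> L \<union> {UNIV}" and J: "J \<in> L \<union> {UNIV}" and "I \<noteq> J"
      have ids: "nr_ideal mul I" "nr_ideal mul J" using I J verts by (auto simp: cig_verts_def)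
      have "nr_ideal mul (I + J) \<and> I + J \<noteq> M"
      proof (cases "I = UNIV \<or> J = UNIV")
        case True
        then show ?thesis using absorb ids nr_ideal_UNIV \<open>M \<noteq> UNIV\<close> by auto
      next
        case False
        then have IJ: "vec.subspace I" "I \<subseteq> M" "vec.dim I \<le> m div 2"
          "vec.subspace J" "J \<subseteq> M" "vec.dim J \<le> m div 2" using I J by (auto simp: L_def)
        \<comment> \<open>For odd \<open>m\<close> the halves add up to \<open>m - 1\<close>, so two
          members of \<open>L\<close> cannot sum to \<open>M\<close>.\<close>
        have "m div 2 + m div 2 < m" using \<open>odd m\<close> by presburger
        then have "vec.dim (I + J) < m" using dim_set_plus_Int[OF IJ(1,4)] IJ(3,6) by linarith
        moreover have "nr_ideal mul (I + J)"
          using ideals subspace_set_plus[OF IJ(1,4)] set_plus_subset_subspace[OF M IJ(2,5)]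
          by blast
        ultimately show ?thesis using \<open>m = vec.dim M\<close> by auto
      qed
      then show "cig_adj mul I J"
        using ids \<open>I \<noteq> J\<close> comp by (simp add: cig_adj_def cig_verts_def)
    qed
  next
    show "finite (cig_verts mul)" by simp
  next
    fix D assume D: "complete_in (cig_verts mul) (cig_adj mul) D"
    \<comment> \<open>Without \<open>UNIV\<close> only subspaces of \<open>M\<close> remain, and
      adjacency forbids the sum \<open>M\<close>. Restoring \<open>UNIV\<close> costs at most one on
      the left and exactly one on the right.\<close>
    have "card (D - {UNIV}) \<le> card L"
      unfolding L_def \<open>m = vec.dim M\<close>
    proof (rule card_subspace_family_le[OF M])
      show "odd (vec.dim M)" using \<open>odd m\<close> \<open>m = vec.dim M\<close> by simp
      show "vec.subspace I \<and> I \<subseteq> M" if "I \<in> D - {UNIV}" for I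
        using that D ideals by (auto simp: complete_in_def cig_verts_def)
      show "I + J \<noteq> M" if "I \<in> D - {UNIV}" "J \<in> D - {UNIV}" "I \<noteq> J" for I J
        using that D comp by (auto simp: complete_in_def cig_adj_def)
    qed
    moreover have "card D \<le> Suc (card (D - {UNIV}))"
      by (metis card_Suc_Diff1 Diff_empty Diff_insert0 finite le_Suc_eq order_refl)
    moreover have "card (L \<union> {UNIV}) = Suc (card L)" using \<open>UNIV \<notin> L\<close> by simp
    ultimately show "card D \<le> card (L \<union> {UNIV})" by linarith
  qed
qed

end
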